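(* Let $P$ and $Q$ be probability distributions on finite sets $\mathcal X$ and $\mathcal Y$ with $H(Q)>0$. For every $\nu\in(0,1)$, $$\mathcal R^{1,\mathcal D}_{P,Q}(\nu)=\mathcal R^{1,\mathcal M}_{P,Q}(\nu)=\left\{(s_1,t_1)\ \Big|\ 0<s_1,\ 0<t_1\le \frac{\min\{H(P),s_1\}}{H(Q)}\right\}.$$
   Context: All logarithms are to base $2$. $\mathcal P(\mathcal X)$ is the set of probability distributions on a finite set $\mathcal X$; $P^n$ is the $n$-fold i.i.d. product on $\mathcal X^n$. $H(P)=-\sum_x P(x)\log P(x)$ is the Shannon entropy. For a map $f:\mathcal X\to\mathcal Y$, $W_f(P)(y)=\sum_{x\in f^{-1}(y)}P(x)$ (a deterministic conversion). The fidelity of two distributions on the same finite set is $F(Q,Q')=\sum_y\sqrt{Q(y)}\sqrt{Q'(y)}$. $P^{\downarrow}_i$ is the $i$-th largest value of $P$ (and $0$ beyond the size of the set). $P\prec Q$ (majorization; possibly different finite sets) means $\sum_{i=1}^l P^{\downarrow}_i\le\sum_{i=1}^l Q^{\downarrow}_i$ for all $l$. A storage of $N$ bits is $K_N=\{0,1\}^N$; for real $N\ge0$ it is a set of $\lfloor 2^N\rfloor$ elements. For $P\in\mathcal P(\mathcal X)$, $Q\in\mathcal P(\mathcal Y)$, $$F^{\mathcal D}(P\to Q|N)=\sup_{f:\mathcal X\to K_N,\ f':K_N\to\mathcal Y}F(W_{f'}\circ W_f(P),Q),$$ $$F^{\mathcal M}(P\to Q|N)=\sup\{F(P'',Q)\mid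 P''\in\mathcal P(\mathcal Y),\ \exists P'\in\mathcal P(K_N):\ P\prec P'\prec P''\}.$$ For $i\in\{\mathcal D,\mathcal M\}$, $\mathcal R^{1,i}_{P,Q}(\nu)$ is the set of pairs $(s_1,t_1)$ with $s_1,t_1>0$ for which there exist sequences $S_n=s_1n+o(n)$ (nonnegative reals) and $T_n=t_1n+o(n)$ (nonnegative integers) with $\liminf_{n\to\infty}F^i(P^n\to Q^{T_n}|S_n)\ge\nu$. *)

theory Defs
  imports "HOL-Probability.Probability" "HOL-Library.Landau_Symbols" "HOL-Library.More_List"
begin

text \<open>
  A distribution on a finite set \<open>X\<close> is a pmf whose support is contained in \<open>X\<close>.  The carrier is kept
  explicit because the sizes of the sets involved (\<open>X\<^sup>n\<close>, the storage) vary inside the statement.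
\<close>

definition dists_on :: "'a set \<Rightarrow> 'a pmf set" where
  "dists_on X = {P. set_pmf P \<subseteq> X}"

definition shannon_entropy :: "'a set \<Rightarrow> 'a pmf \<Rightarrow> real" where
  "shannon_entropy X P = - (\<Sum>x\<in>X. pmf P x * log 2 (pmf P x))"

definition fidelity :: "'a set \<Rightarrow> 'a pmf \<Rightarrow> 'a pmf \<Rightarrow> real" where
  "fidelity Y Q Q' = (\<Sum>y\<in>Y. sqrt (pmf Q y) * sqrt (pmf Q' y))"

text \<open>Indexed from \<open>0\<close>: \<open>decreasing_probs X P i\<close> is the \<open>(i + 1)\<close>-th largest probability, counted with
  multiplicity, and \<open>0\<close> for \<open>i \<ge> card X\<close>.\<close>

definition decreasing_probs :: "'a set \<Rightarrow> 'a pmf \<Rightarrow> nat \<Rightarrow> real" where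
  "decreasing_probs X P =
     nth_default 0 (rev (sorted_list_of_multiset (image_mset (pmf P) (mset_set X))))"

definition majorized :: "'a set \<Rightarrow> 'a pmf \<Rightarrow> 'b set \<Rightarrow> 'b pmf \<Rightarrow> bool" where
  "majorized X P Y Q \<longleftrightarrow>
     (\<forall>l. (\<Sum>i<l. decreasing_probs X P i) \<le> (\<Sum>i<l. decreasing_probs Y Q i))"

definition storage :: "real \<Rightarrow> nat set" where
  "storage N = {..<nat \<lfloor>2 powr N\<rfloor>}"

text \<open>The deterministic conversion \<open>W\<^sub>f\<close> is \<open>map_pmf f\<close>; values of \<open>f\<close> off the carrier are irrelevant.\<close>

lemma pmf_conversion:
  assumes "finite X" "P \<in> dists_on X"
  shows "pmf (map_pmf f P) y = (\<Sum>x\<in>{x\<in>X. f x = y}. pmf P x)"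
proof -
  have "pmf (map_pmf f P) y = measure P (f -` {y})"
    by (rule pmf_map)
  also have "\<dots> = measure P (f -` {y} \<inter> X)"
    using assms by (intro measure_pmf.finite_measure_eq_AE) (auto simp: AE_measure_pmf_iff dists_on_def)
  also have "f -` {y} \<inter> X = {x\<in>X. f x = y}"
    by auto
  also have "measure P {x\<in>X. f x = y} = (\<Sum>x\<in>{x\<in>X. f x = y}. pmf P x)"
    using assms by (simp add: measure_measure_pmf_finite)
  finally show ?thesis .
qed

definition F_det :: "'a set \<Rightarrow> 'a pmf \<Rightarrow> 'b set \<Rightarrow> 'b pmf \<Rightarrow> real \<Rightarrow> real" where
  "F_det X P Y Q N =
     Sup {fidelity Y (map_pmf f' (map_pmf f P)) Q | f f'.
            f \<in> X \<rightarrow> storage N \<and> f' \<in> storage N \<rightarrow> Y}"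

definition F_maj :: "'a set \<Rightarrow> 'a pmf \<Rightarrow> 'b set \<Rightarrow> 'b pmf \<Rightarrow> real \<Rightarrow> real" where
  "F_maj X P Y Q N =
     Sup {fidelity Y P'' Q | P''. P'' \<in> dists_on Y \<and>
            (\<exists>P'\<in>dists_on (storage N). majorized X P (storage N) P' \<and> majorized (storage N) P' Y P'')}"

text \<open>\<open>X\<^sup>n\<close> consists of the lists of length \<open>n\<close> over \<open>X\<close>, and \<open>P\<^sup>n\<close> is \<open>replicate_pmf n P\<close>.\<close>

definition words :: "'a set \<Rightarrow> nat \<Rightarrow> 'a list set" where
  "words X n = {xs. set xs \<subseteq> X \<and> length xs = n}"

lemma pmf_iid_product:
  assumes "length xs = n"
  shows "pmf (replicate_pmf n P) xs = (\<Prod>x\<leftarrow>xs. pmf P x)"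
  using assms
proof (induction n arbitrary: xs)
  case 0
  then show ?case by simp
next
  case (Suc n)
  then obtain x ys where xs: "xs = x # ys" and len: "length ys = n"
    by (cases xs) auto
  have eq: "replicate_pmf (Suc n) P = map_pmf (\<lambda>(x, ys). x # ys) (pair_pmf P (replicate_pmf n P))"
    by (simp add: pair_pmf_def map_pmf_def bind_assoc_pmf bind_return_pmf)
  have "pmf (replicate_pmf (Suc n) P) xs = pmf (pair_pmf P (replicate_pmf n P)) (x, ys)"
    unfolding eq xs
    using pmf_map_inj'[of "\<lambda>(x, ys). x # ys" "pair_pmf P (replicate_pmf n P)" "(x, ys)"]
    by (auto simp: inj_on_def)
  then show ?case
    by (simp add: pmf_pair xs Suc.IH[OF len])
qed

text \<open>The first argument is \<open>F_det\<close> or \<open>F_maj\<close>.\<close>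

definition rate_region ::
  "('a list set \<Rightarrow> 'a list pmf \<Rightarrow> 'b list set \<Rightarrow> 'b list pmf \<Rightarrow> real \<Rightarrow> real) \<Rightarrow>
   'a set \<Rightarrow> 'a pmf \<Rightarrow> 'b set \<Rightarrow> 'b pmf \<Rightarrow> real \<Rightarrow> (real \<times> real) set" where
  "rate_region F X P Y Q \<nu> = {(s\<^sub>1, t\<^sub>1). 0 < s\<^sub>1 \<and> 0 < t\<^sub>1 \<and>
     (\<exists>(S :: nat \<Rightarrow> real) (T :: nat \<Rightarrow> nat).
        (\<forall>n. 0 \<le> S n) \<and>
        (\<lambda>n. S n - s\<^sub>1 * real n) \<in> o(\<lambda>n. real n) \<and>
        (\<lambda>n. real (T n) - t\<^sub>1 * real n) \<in> o(\<lambda>n. real n) \<and>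
        ereal \<nu> \<le> liminf (\<lambda>n. ereal
          (F (words X n) (replicate_pmf n P) (words Y (T n)) (replicate_pmf (T n) Q) (S n))))}"

end

theory Submission
  imports Defs "HOL-Real_Asymp.Real_Asymp"
begin

text \<open>
  By Chebyshev's inequality almost all of the mass of \<open>P\<^sup>n\<close> sits on words of probability
  \<open>2\<close> to the power \<open>- n H(P) \<plusminus> n\<^bsup>2/3\<^esup>\<close>.

  Converse: if \<open>P\<^sup>n \<prec> P' \<prec> P''\<close>, then \<open>P''\<close> is concentrated, up to a vanishing mass, on a set
  \<open>B\<close> no larger than the typical set of \<open>P\<^sup>n\<close>, and entirely on a set \<open>B\<close> no larger than the
  storage.  If the size of \<open>B\<close> has a smaller exponential rate than \<open>t\<^sub>1 H(Q)\<close>, then \<open>Q\<^sup>T(B)\<close>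
  tends to \<open>0\<close>, and so does the fidelity, by Cauchy-Schwarz on \<open>B\<close> and on its complement.

  Achievability: \<open>T\<^sub>n = t\<^sub>1 n - n\<^bsup>3/4\<^esup>\<close> makes each typical word of \<open>P\<^sup>n\<close> negligible against each
  typical word of \<open>Q\<^sup>T\<close>, because \<open>n\<^bsup>3/4\<^esup>\<close> dominates the fluctuations, so the former can be
  distributed greedily over the latter with small relative error.  The image of this map is the
  typical set of \<open>Q\<^sup>T\<close>, which fits into the storage, so the map factors through the storage.

  A deterministic conversion produces a distribution that majorizes its input, hence
  \<open>F_det \<le> F_maj\<close> and both regions coincide.
\<close>

section \<open>Typical sequences\<close>

lemma finite_set_replicate_pmf:
  "finite (set_pmf P) \<Longrightarrow> finite (set_pmf (replicate_pmf n P))"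
  by (simp add: set_replicate_pmf finite_lists_length_eq lists_eq_set)

lemma expectation_replicate_pmf_Suc:
  fixes f :: "'a list \<Rightarrow> real"
  assumes "finite (set_pmf P)"
  shows "measure_pmf.expectation (replicate_pmf (Suc n) P) f =
    (\<Sum>x\<in>set_pmf P. pmf P x * measure_pmf.expectation (replicate_pmf n P) (\<lambda>xs. f (x # xs)))"
  using assms finite_set_replicate_pmf[OF assms, of n]
  by (simp add: pmf_expectation_bind[of "set_pmf P"] flip: map_pmf_def)

lemma sum_pmf_set_pmf: "finite (set_pmf P) \<Longrightarrow> (\<Sum>x\<in>set_pmf P. pmf P x) = 1"
  by (rule sum_pmf_eq_1) auto

text \<open>Variances of independent centered summands add: splitting off the first letter leaves a
  cross term whose expectation vanishes by the first claim. This is why both claims share one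
  induction.\<close>

lemma expectation_sum_list_centered:
  fixes h :: "'a \<Rightarrow> real"
  assumes fin: "finite (set_pmf P)" and mean: "(\<Sum>x\<in>set_pmf P. pmf P x * h x) = 0"
  shows "measure_pmf.expectation (replicate_pmf n P) (\<lambda>xs. \<Sum>x\<leftarrow>xs. h x) = 0"
    and "measure_pmf.expectation (replicate_pmf n P) (\<lambda>xs. (\<Sum>x\<leftarrow>xs. h x)\<^sup>2) =
      real n * (\<Sum>x\<in>set_pmf P. pmf P x * (h x)\<^sup>2)"
proof (induction n)
  case 0
  show "measure_pmf.expectation (replicate_pmf 0 P) (\<lambda>xs. \<Sum>x\<leftarrow>xs. h x) = 0"
    "measure_pmf.expectation (replicate_pmf 0 P) (\<lambda>xs. (\<Sum>x\<leftarrow>xs. h x)\<^sup>2) =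
      real 0 * (\<Sum>x\<in>set_pmf P. pmf P x * (h x)\<^sup>2)"
    by simp_all
next
  case (Suc n)
  define V where "V = (\<Sum>x\<in>set_pmf P. pmf P x * (h x)\<^sup>2)"
  have int: "integrable (replicate_pmf n P) f" for f :: "'a list \<Rightarrow> real"
    by (rule integrable_measure_pmf_finite) (rule finite_set_replicate_pmf[OF fin])
  let ?E = "measure_pmf.expectation (replicate_pmf n P)"
  have "?E (\<lambda>xs. h x + (\<Sum>x\<leftarrow>xs. h x)) = h x" for x
    using Suc.IH(1) by (subst Bochner_Integration.integral_add) (auto intro!: int)
  then show "measure_pmf.expectation (replicate_pmf (Suc n) P) (\<lambda>xs. \<Sum>x\<leftarrow>xs. h x) = 0"
    using mean by (simp only: expectation_replicate_pmf_Suc[OF fin]) simp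
  have "?E (\<lambda>xs. (h x + (\<Sum>x\<leftarrow>xs. h x))\<^sup>2) = (h x)\<^sup>2 + real n * V" for x
  proof -
    have "?E (\<lambda>xs. (h x + (\<Sum>x\<leftarrow>xs. h x))\<^sup>2) =
        ?E (\<lambda>xs. ((h x)\<^sup>2 + 2 * h x * (\<Sum>x\<leftarrow>xs. h x)) + (\<Sum>x\<leftarrow>xs. h x)\<^sup>2)"
      by (simp add: power2_sum algebra_simps)
    also have "\<dots> = (?E (\<lambda>xs. (h x)\<^sup>2) + ?E (\<lambda>xs. 2 * h x * (\<Sum>x\<leftarrow>xs. h x)))
        + ?E (\<lambda>xs. (\<Sum>x\<leftarrow>xs. h x)\<^sup>2)"
      by (subst Bochner_Integration.integral_add[OF int int])+ simp
    finally show ?thesis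
      using Suc.IH by (simp add: V_def)
  qed
  then show "measure_pmf.expectation (replicate_pmf (Suc n) P) (\<lambda>xs. (\<Sum>x\<leftarrow>xs. h x)\<^sup>2) =
      real (Suc n) * (\<Sum>x\<in>set_pmf P. pmf P x * (h x)\<^sup>2)"
    using sum_pmf_set_pmf[OF fin]
    by (simp only: expectation_replicate_pmf_Suc[OF fin])
       (simp add: V_def[symmetric] distrib_left distrib_right sum.distrib flip: sum_distrib_right)
qed

text \<open>The variance of the log-probability of one letter, whose mean is minus the entropy.
  Summing over the support keeps the carrier out of the concentration bounds.\<close>

definition info_variance :: "'a pmf \<Rightarrow> real" where
  "info_variance P =
    (\<Sum>x\<in>set_pmf P. pmf P x * (log 2 (pmf P x) + shannon_entropy (set_pmf P) P)\<^sup>2)"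

lemma shannon_entropy_set_pmf:
  assumes "finite X" "P \<in> dists_on X"
  shows "shannon_entropy (set_pmf P) P = shannon_entropy X P"
  unfolding shannon_entropy_def
  using assms by (auto simp: dists_on_def set_pmf_eq intro!: sum.mono_neutral_left)

lemma log_pmf_replicate_pmf:
  assumes "xs \<in> set_pmf (replicate_pmf n P)"
  shows "log 2 (pmf (replicate_pmf n P) xs) = (\<Sum>x\<leftarrow>xs. log 2 (pmf P x))"
proof -
  have len: "length xs = n" and sub: "set xs \<subseteq> set_pmf P"
    using assms by (auto simp: set_replicate_pmf)
  \<comment> \<open>Positivity is carried through the induction because the logarithm of a product
    splits only for nonzero factors.\<close>
  have "0 < (\<Prod>x\<leftarrow>xs. pmf P x) \<and> log 2 (\<Prod>x\<leftarrow>xs. pmf P x) = (\<Sum>x\<leftarrow>xs. log 2 (pmf P x))"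
    using sub by (induction xs) (auto simp: log_mult pmf_positive pmf_eq_0_set_pmf)
  then show ?thesis
    by (simp add: pmf_iid_product[OF len])
qed

text \<open>Chebyshev's inequality: on the support, the log-probability of a word plus
  \<open>n\<close> times the entropy is a sum of \<open>n\<close> independent copies of the centered
  variable \<open>h\<close>.\<close>

lemma typicality:
  assumes fin: "finite (set_pmf P)" and "a > 0"
  shows "measure (replicate_pmf n P) {xs \<in> set_pmf (replicate_pmf n P).
      a \<le> \<bar>log 2 (pmf (replicate_pmf n P) xs) + real n * shannon_entropy (set_pmf P) P\<bar>}
    \<le> real n * info_variance P / a\<^sup>2"
proof -
  define h where "h x = log 2 (pmf P x) + shannon_entropy (set_pmf P) P" for x
  have mean: "(\<Sum>x\<in>set_pmf P. pmf P x * h x) = 0"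
    using sum_pmf_set_pmf[OF fin]
    by (simp add: h_def distrib_left sum.distrib flip: sum_distrib_right)
       (simp add: shannon_entropy_def)
  have "log 2 (pmf (replicate_pmf n P) xs) + real n * shannon_entropy (set_pmf P) P = (\<Sum>x\<leftarrow>xs. h x)"
    if "xs \<in> set_pmf (replicate_pmf n P)" for xs
  proof -
    have "length xs = n" using that by (auto simp: set_replicate_pmf)
    then show ?thesis
      by (simp add: log_pmf_replicate_pmf[OF that] h_def sum_list_addf sum_list_triv)
  qed
  then have "measure (replicate_pmf n P) {xs \<in> set_pmf (replicate_pmf n P).
      a \<le> \<bar>log 2 (pmf (replicate_pmf n P) xs) + real n * shannon_entropy (set_pmf P) P\<bar>}
    \<le> measure (replicate_pmf n P) {xs \<in> space (replicate_pmf n P). a \<le> \<bar>\<Sum>x\<leftarrow>xs. h x\<bar>}"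
    by (intro measure_pmf.finite_measure_mono) auto
  also have "\<dots> \<le> measure_pmf.expectation (replicate_pmf n P) (\<lambda>xs. (\<Sum>x\<leftarrow>xs. h x)\<^sup>2) / a\<^sup>2"
    using \<open>a > 0\<close>
    by (intro measure_pmf.second_moment_method)
       (auto intro!: integrable_measure_pmf_finite finite_set_replicate_pmf[OF fin])
  also have "\<dots> = real n * info_variance P / a\<^sup>2"
    by (subst expectation_sum_list_centered(2)[OF fin mean]) (simp add: info_variance_def h_def)
  finally show ?thesis .
qed

lemma measure_large_pmf:
  assumes fin: "finite (set_pmf P)" and "a > 0"
  shows "measure (replicate_pmf n P) {xs. 2 powr - (real n * shannon_entropy (set_pmf P) P - a)
      \<le> pmf (replicate_pmf n P) xs} \<le> real n * info_variance P / a\<^sup>2"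
proof -
  have "measure (replicate_pmf n P) {xs. 2 powr - (real n * shannon_entropy (set_pmf P) P - a)
      \<le> pmf (replicate_pmf n P) xs}
    = measure (replicate_pmf n P) ({xs. 2 powr - (real n * shannon_entropy (set_pmf P) P - a)
      \<le> pmf (replicate_pmf n P) xs} \<inter> set_pmf (replicate_pmf n P))"
    by (simp add: measure_Int_set_pmf)
  also have "\<dots> \<le> measure (replicate_pmf n P) {xs \<in> set_pmf (replicate_pmf n P).
      a \<le> \<bar>log 2 (pmf (replicate_pmf n P) xs) + real n * shannon_entropy (set_pmf P) P\<bar>}"
    by (intro measure_pmf.finite_measure_mono)
       (auto simp: pmf_positive_iff le_log_iff[symmetric])
  finally show ?thesis
    using typicality[OF assms, of n] by linarith
qed

text \<open>The set contains every list of probability 0. Intersecting with the support discards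
  these without changing the measure, and only there does the logarithm turn the condition into a
  deviation.\<close>

lemma measure_small_pmf:
  assumes fin: "finite (set_pmf P)" and "a > 0"
  shows "measure (replicate_pmf n P) {xs. pmf (replicate_pmf n P) xs
      \<le> 2 powr - (real n * shannon_entropy (set_pmf P) P + a)} \<le> real n * info_variance P / a\<^sup>2"
proof -
  have "measure (replicate_pmf n P) {xs. pmf (replicate_pmf n P) xs
      \<le> 2 powr - (real n * shannon_entropy (set_pmf P) P + a)}
    = measure (replicate_pmf n P) ({xs. pmf (replicate_pmf n P) xs
      \<le> 2 powr - (real n * shannon_entropy (set_pmf P) P + a)} \<inter> set_pmf (replicate_pmf n P))"
    by (simp add: measure_Int_set_pmf)
  also have "\<dots> \<le> measure (replicate_pmf n P) {xs \<in> set_pmf (replicate_pmf n P).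
      a \<le> \<bar>log 2 (pmf (replicate_pmf n P) xs) + real n * shannon_entropy (set_pmf P) P\<bar>}"
    by (intro measure_pmf.finite_measure_mono)
       (auto simp: pmf_positive_iff log_le_iff[symmetric])
  finally show ?thesis
    using typicality[OF assms, of n] by linarith
qed

lemma card_pmf_ge:
  assumes "q > 0"
  shows "finite {x. q \<le> pmf P x}" and "real (card {x. q \<le> pmf P x}) \<le> 1 / q"
proof -
  \<comment> \<open>Total mass 1 limits every finite subset first, since finiteness of the whole set
    is itself to be shown: an infinite set would have finite subsets beyond this bound.\<close>
  have bound: "real (card F) \<le> 1 / q" if "finite F" "F \<subseteq> {x. q \<le> pmf P x}" for F
  proof -
    have "real (card F) * q = (\<Sum>x\<in>F. q)" by simp
    also have "\<dots> \<le> (\<Sum>x\<in>F. pmf P x)" using that by (intro sum_mono) auto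
    also have "\<dots> \<le> 1"
      using that by (simp flip: measure_measure_pmf_finite)
    finally show ?thesis using assms by (simp add: field_simps)
  qed
  show fin: "finite {x. q \<le> pmf P x}"
  proof (rule ccontr)
    assume "infinite {x. q \<le> pmf P x}"
    then obtain F where "finite F" "card F = Suc (nat \<lceil>1 / q\<rceil>)" "F \<subseteq> {x. q \<le> pmf P x}"
      using infinite_arbitrarily_large by blast
    with bound[of F] show False by simp linarith
  qed
  show "real (card {x. q \<le> pmf P x}) \<le> 1 / q"
    using bound[OF fin] by simp
qed

section \<open>Majorization\<close>

text \<open>Sorting the elements of the carrier instead of their probabilities keeps track of who
  owns each value, so that partial sums become masses of sets.\<close>

lemma decreasing_probs_enumeration:
  assumes "finite X"
  obtains xs where "distinct xs" "set xs = X" "sorted_wrt (\<ge>) (map (pmf P) xs)"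
    "decreasing_probs X P = nth_default 0 (map (pmf P) xs)"
proof -
  define xs where "xs = rev (sort_key (pmf P) (SOME l. distinct l \<and> set l = X))"
  have "\<exists>l. distinct l \<and> set l = X"
    using finite_distinct_list[OF assms] by blast
  then have l: "distinct (SOME l. distinct l \<and> set l = X)" "set (SOME l. distinct l \<and> set l = X) = X"
    by (metis (mono_tags, lifting) someI_ex)+
  have d: "distinct xs" "set xs = X"
    using l by (simp_all add: xs_def)
  have s: "sorted (rev (map (pmf P) xs))"
    by (simp add: xs_def rev_map)
  have "image_mset (pmf P) (mset_set X) = mset (rev (map (pmf P) xs))"
    using d mset_set_set by force
  then have "rev (sorted_list_of_multiset (image_mset (pmf P) (mset_set X))) = map (pmf P) xs"
    using s by (metis rev_swap sorted_list_of_multiset_mset sorted_sort_id)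
  then show thesis
    using that[OF d] s by (simp add: decreasing_probs_def sorted_wrt_rev)
qed

text \<open>Indices past the end contribute the default 0, so \<open>l\<close> may exceed the length
  of the list.\<close>

lemma sum_nth_default_prefix:
  fixes f :: "'a \<Rightarrow> real"
  assumes "distinct xs"
  shows "(\<Sum>i<l. nth_default 0 (map f xs) i) = (\<Sum>x\<in>set (take l xs). f x)"
proof -
  have "(\<Sum>i<l. nth_default 0 (map f xs) i) = (\<Sum>i<min l (length xs). f (xs ! i))"
    by (intro sum.mono_neutral_cong_right) (auto simp: nth_default_def)
  also have "\<dots> = (\<Sum>x\<leftarrow>take l xs. f x)"
    by (simp add: sum_list_sum_nth atLeast0LessThan min.commute)
  also have "\<dots> = (\<Sum>x\<in>set (take l xs). f x)"
    using assms by (simp add: sum_list_distinct_conv_sum_set)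
  finally show ?thesis .
qed

text \<open>With \<open>sum_le_sum_decreasing_probs\<close> this identifies the partial sum as the
  largest mass of a set of at most \<open>l\<close> elements. Apart from transitivity, majorization
  is handled only in this form.\<close>

lemma sum_decreasing_probs_attained:
  assumes "finite X"
  obtains B where "B \<subseteq> X" "card B \<le> l" "(\<Sum>i<l. decreasing_probs X P i) = (\<Sum>x\<in>B. pmf P x)"
proof -
  obtain xs where xs: "distinct xs" "set xs = X"
    "decreasing_probs X P = nth_default 0 (map (pmf P) xs)"
    using decreasing_probs_enumeration[OF assms] by metis
  show thesis
  proof (rule that)
    show "set (take l xs) \<subseteq> X" using xs(2) set_take_subset by metis
    show "card (set (take l xs)) \<le> l" using card_length[of "take l xs"] by simp
  qed (simp add: xs(3) sum_nth_default_prefix[OF xs(1)])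
qed

text \<open>An exchange argument against the set \<open>B\<close> of the first \<open>l\<close>
  elements. The first element outside \<open>B\<close> has weight \<open>c\<close>; whatever
  \<open>A\<close> has beyond \<open>B\<close> weighs at most \<open>c\<close> each, whatever it
  misses weighs at least \<open>c\<close> each, and it misses at least as many as it adds.\<close>

lemma sum_le_sum_decreasing_probs:
  assumes "finite X" "A \<subseteq> X" "card A \<le> l"
  shows "(\<Sum>x\<in>A. pmf P x) \<le> (\<Sum>i<l. decreasing_probs X P i)"
proof -
  obtain xs where xs: "distinct xs" "set xs = X" "sorted_wrt (\<ge>) (map (pmf P) xs)"
    "decreasing_probs X P = nth_default 0 (map (pmf P) xs)"
    using decreasing_probs_enumeration[OF assms(1)] by metis
  define B where "B = set (take l xs)"
  have "(\<Sum>x\<in>A. pmf P x) \<le> (\<Sum>x\<in>B. pmf P x)"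
  proof (cases "length xs \<le> l")
    case True
    then show ?thesis
      using assms xs(2) by (auto simp: B_def intro!: sum_mono2)
  next
    case False
    define c where "c = pmf P (xs ! l)"
    have cardB: "card B = l" using False xs(1) by (simp add: B_def distinct_card)
    have fin: "finite A" "finite B" using assms finite_subset by (auto simp: B_def)
    have nth: "pmf P (xs ! i) \<ge> pmf P (xs ! j)" if "i \<le> j" "j < length xs" for i j
      using that xs(3) by (cases "i = j") (auto simp: sorted_wrt_iff_nth_less)
    have lo: "c \<le> pmf P x" if x: "x \<in> B" for x
    proof -
      obtain i where "i < l" "x = xs ! i"
        using x False by (auto simp: B_def in_set_conv_nth)
      then show ?thesis using nth[of i l] False by (simp add: c_def)
    qed
    have hi: "pmf P x \<le> c" if x: "x \<in> A" "x \<notin> B" for x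
    proof -
      obtain i where i: "i < length xs" "x = xs ! i"
        using x assms(2) xs(2) by (metis in_set_conv_nth subsetD)
      have "\<not> i < l"
        using i x(2) False by (auto simp: B_def in_set_conv_nth)
      then show ?thesis using nth[of l i] i by (simp add: c_def)
    qed
    have "card (A - B) \<le> card (B - A)"
      using fin cardB assms(3) card_Diff_subset_Int[of A B] card_Diff_subset_Int[of B A]
      by (simp add: Int_commute diff_le_mono)
    then have "real (card (A - B)) * c \<le> real (card (B - A)) * c"
      by (intro mult_right_mono) (auto simp: c_def)
    moreover have "(\<Sum>x\<in>A - B. pmf P x) \<le> real (card (A - B)) * c"
      using hi by (intro sum_bounded_above) auto
    moreover have "real (card (B - A)) * c \<le> (\<Sum>x\<in>B - A. pmf P x)"
      using lo by (intro sum_bounded_below) auto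
    ultimately have "(\<Sum>x\<in>A - B. pmf P x) \<le> (\<Sum>x\<in>B - A. pmf P x)" by linarith
    moreover have "(\<Sum>x\<in>A. pmf P x) = (\<Sum>x\<in>A - B. pmf P x) + (\<Sum>x\<in>A \<inter> B. pmf P x)"
      using sum.Int_Diff[OF fin(1), of "pmf P" B] by simp
    moreover have "(\<Sum>x\<in>B. pmf P x) = (\<Sum>x\<in>B - A. pmf P x) + (\<Sum>x\<in>A \<inter> B. pmf P x)"
      using sum.Int_Diff[OF fin(2), of "pmf P" A] by (simp add: Int_commute)
    ultimately show ?thesis by linarith
  qed
  then show ?thesis
    by (simp add: B_def xs(4) sum_nth_default_prefix[OF xs(1)])
qed

text \<open>The image of a set has no more elements than the set and at least its mass.\<close>

lemma majorized_map_pmf: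
  assumes "finite X" "finite Y" "P \<in> dists_on X" "f \<in> X \<rightarrow> Y"
  shows "majorized X P Y (map_pmf f P)"
  unfolding majorized_def
proof
  fix l
  obtain B where B: "B \<subseteq> X" "card B \<le> l" "(\<Sum>i<l. decreasing_probs X P i) = (\<Sum>x\<in>B. pmf P x)"
    using sum_decreasing_probs_attained[OF assms(1)] by metis
  have finB: "finite B" using B(1) assms(1) finite_subset by blast
  have "(\<Sum>x\<in>B. pmf P x) = measure P B"
    using finB by (simp add: measure_measure_pmf_finite)
  also have "\<dots> \<le> measure P (f -` f ` B)"
    by (intro measure_pmf.finite_measure_mono) auto
  also have "\<dots> = (\<Sum>y\<in>f ` B. pmf (map_pmf f P) y)"
    using finB by (simp flip: measure_measure_pmf_finite)
  also have "\<dots> \<le> (\<Sum>i<l. decreasing_probs Y (map_pmf f P) i)"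
    using assms B finB card_image_le[of B f] by (intro sum_le_sum_decreasing_probs) auto
  finally show "(\<Sum>i<l. decreasing_probs X P i) \<le> (\<Sum>i<l. decreasing_probs Y (map_pmf f P) i)"
    by (simp add: B(3))
qed

section \<open>Fidelity\<close>

lemma sum_sqrt_mult_le:
  assumes "finite A"
  shows "(\<Sum>y\<in>A. sqrt (pmf P y) * sqrt (pmf Q y)) \<le> sqrt (measure P A) * sqrt (measure Q A)"
proof -
  have "(\<Sum>y\<in>A. sqrt (pmf P y) * sqrt (pmf Q y))\<^sup>2
      \<le> (\<Sum>y\<in>A. (sqrt (pmf P y))\<^sup>2) * (\<Sum>y\<in>A. (sqrt (pmf Q y))\<^sup>2)"
    by (rule Cauchy_Schwarz_ineq_sum)
  also have "\<dots> = measure P A * measure Q A"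
    using assms by (simp add: measure_measure_pmf_finite)
  finally show ?thesis
    by (simp add: real_le_rsqrt flip: real_sqrt_mult)
qed

lemma fidelity_le_1:
  assumes "finite Y"
  shows "fidelity Y P Q \<le> 1"
proof -
  have "sqrt (measure P Y) * sqrt (measure Q Y) \<le> 1"
    by (intro mult_le_one) auto
  then show ?thesis
    using sum_sqrt_mult_le[OF assms, of P Q] by (simp add: fidelity_def)
qed

text \<open>The common core of both converse bounds. Majorization turns the mass of \<open>A\<close>
  into mass of \<open>P''\<close> on some \<open>B\<close> with at most \<open>card A\<close>
  elements. By Cauchy-Schwarz, \<open>B\<close> contributes at most the root of its mass under
  \<open>Q\<close>, and the rest at most the root of its mass under \<open>P''\<close>.\<close>

lemma fidelity_le_of_majorized:
  fixes P :: "'a pmf" and Q :: "'b pmf"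
  assumes "finite X" "finite Y" "P'' \<in> dists_on Y" "majorized X P Y P''"
    and "A \<subseteq> X" "1 - \<epsilon> \<le> measure P A" "real (card A) \<le> L"
    and "measure Q {y. q \<le> pmf Q y} \<le> \<delta>" "q \<ge> 0"
  shows "fidelity Y P'' Q \<le> sqrt (\<delta> + L * q) + sqrt \<epsilon>"
proof -
  have finA: "finite A" using assms finite_subset by blast
  obtain B where B: "B \<subseteq> Y" "card B \<le> card A"
    "(\<Sum>i<card A. decreasing_probs Y P'' i) = (\<Sum>x\<in>B. pmf P'' x)"
    using sum_decreasing_probs_attained[OF assms(2)] by metis
  have finB: "finite B" using B(1) assms(2) finite_subset by blast
  have "1 - \<epsilon> \<le> (\<Sum>x\<in>A. pmf P x)"
    using assms(6) finA by (simp add: measure_measure_pmf_finite)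
  also have "\<dots> \<le> (\<Sum>i<card A. decreasing_probs X P i)"
    using assms by (intro sum_le_sum_decreasing_probs) auto
  also have "\<dots> \<le> (\<Sum>x\<in>B. pmf P'' x)"
    using assms(4) by (simp add: majorized_def flip: B(3))
  finally have PB: "1 - \<epsilon> \<le> measure P'' B"
    using finB by (simp add: measure_measure_pmf_finite)
  have "measure P'' (Y - B) \<le> measure P'' (- B)"
    by (intro measure_pmf.finite_measure_mono) auto
  also have "\<dots> = 1 - measure P'' B"
    using measure_pmf.prob_compl[of B P''] by (simp add: Compl_eq_Diff_UNIV)
  finally have PC: "measure P'' (Y - B) \<le> \<epsilon>" using PB by linarith
  \<comment> \<open>Splitting at the threshold \<open>q\<close>: the likely elements have total mass
    at most \<open>\<delta>\<close>, and there are at most \<open>L\<close> others in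
    \<open>B\<close>, each of mass below \<open>q\<close>.\<close>
  have "measure Q B \<le> measure Q ({y. q \<le> pmf Q y} \<union> {y\<in>B. pmf Q y < q})"
    by (intro measure_pmf.finite_measure_mono) auto
  also have "\<dots> \<le> measure Q {y. q \<le> pmf Q y} + measure Q {y\<in>B. pmf Q y < q}"
    by (intro measure_Un_le) auto
  also have "measure Q {y\<in>B. pmf Q y < q} = (\<Sum>y\<in>{y\<in>B. pmf Q y < q}. pmf Q y)"
    using finB by (simp add: measure_measure_pmf_finite)
  also have "\<dots> \<le> real (card {y\<in>B. pmf Q y < q}) * q"
    by (intro sum_bounded_above) auto
  also have "\<dots> \<le> L * q"
  proof -
    have "card {y\<in>B. pmf Q y < q} \<le> card B"
      using finB by (intro card_mono) auto
    then have "real (card {y\<in>B. pmf Q y < q}) \<le> L" using B(2) assms(7) by linarith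
    then show ?thesis using assms(9) by (rule mult_right_mono)
  qed
  finally have QB: "measure Q B \<le> \<delta> + L * q" using assms(8) by linarith
  have "fidelity Y P'' Q = (\<Sum>y\<in>Y - B. sqrt (pmf P'' y) * sqrt (pmf Q y))
      + (\<Sum>y\<in>B. sqrt (pmf P'' y) * sqrt (pmf Q y))"
    unfolding fidelity_def using B(1) assms(2) by (rule sum.subset_diff)
  also have "\<dots> \<le> sqrt (measure P'' (Y - B)) * sqrt (measure Q (Y - B))
      + sqrt (measure P'' B) * sqrt (measure Q B)"
    using assms(2) finB by (intro add_mono sum_sqrt_mult_le) auto
  also have "\<dots> \<le> sqrt \<epsilon> * 1 + 1 * sqrt (\<delta> + L * q)"
    using PC QB order_trans[OF measure_nonneg PC] by (intro add_mono mult_mono) auto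
  finally show ?thesis by simp
qed

section \<open>Comparing the two conversion problems\<close>

lemma finite_storage [simp]: "finite (storage N)"
  by (simp add: storage_def)

lemma zero_in_storage: "N \<ge> 0 \<Longrightarrow> 0 \<in> storage N"
  using ge_one_powr_ge_zero[of 2 N] by (simp add: storage_def)

lemma card_storage_le: "real (card (storage N)) \<le> 2 powr N"
  by (simp add: storage_def)

text \<open>A supremum of reals is informative only for a nonempty bounded set. Constant maps are
  candidates, since a nonnegative capacity leaves at least the cell 0.\<close>

lemma F_det_set_nonempty:
  assumes "Q \<in> dists_on Y" "N \<ge> 0"
  shows "{fidelity Y (map_pmf f' (map_pmf f P)) Q | f f'.
    f \<in> X \<rightarrow> storage N \<and> f' \<in> storage N \<rightarrow> Y} \<noteq> {}"
proof -
  obtain y where "y \<in> Y"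
    using assms(1) set_pmf_not_empty[of Q] by (auto simp: dists_on_def)
  then have "(\<lambda>_. 0) \<in> X \<rightarrow> storage N \<and> (\<lambda>_. y) \<in> storage N \<rightarrow> Y"
    using zero_in_storage[OF assms(2)] by auto
  then show ?thesis by blast
qed

lemma F_det_set_subset:
  assumes "finite X" "finite Y" "P \<in> dists_on X"
  shows "{fidelity Y (map_pmf f' (map_pmf f P)) Q | f f'. f \<in> X \<rightarrow> storage N \<and> f' \<in> storage N \<rightarrow> Y}
    \<subseteq> {fidelity Y P'' Q | P''. P'' \<in> dists_on Y \<and>
        (\<exists>P'\<in>dists_on (storage N). majorized X P (storage N) P' \<and> majorized (storage N) P' Y P'')}"
proof safe
  fix f f' assume f: "f \<in> X \<rightarrow> storage N" "f' \<in> storage N \<rightarrow> Y"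
  have P': "map_pmf f P \<in> dists_on (storage N)"
    using f(1) assms(3) by (auto simp: dists_on_def)
  then have "map_pmf f' (map_pmf f P) \<in> dists_on Y"
    using f(2) by (auto simp: dists_on_def)
  moreover have "majorized X P (storage N) (map_pmf f P)"
    using assms f(1) by (intro majorized_map_pmf) auto
  moreover have "majorized (storage N) (map_pmf f P) Y (map_pmf f' (map_pmf f P))"
    using assms(2) P' f(2) by (intro majorized_map_pmf) auto
  ultimately show "\<exists>P''. fidelity Y (map_pmf f' (map_pmf f P)) Q = fidelity Y P'' Q \<and> P'' \<in> dists_on Y \<and>
      (\<exists>P'\<in>dists_on (storage N). majorized X P (storage N) P' \<and> majorized (storage N) P' Y P'')"
    using P' by (intro exI[of _ "map_pmf f' (map_pmf f P)"] conjI bexI[of _ "map_pmf f P"] refl)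
qed

lemma bdd_above_fidelity:
  assumes "finite Y"
  shows "bdd_above {fidelity Y P Q | P. R P}"
  using fidelity_le_1[OF assms] by (auto intro!: bdd_aboveI[of _ 1])

lemma F_det_le_F_maj:
  assumes "finite X" "finite Y" "P \<in> dists_on X" "Q \<in> dists_on Y" "N \<ge> 0"
  shows "F_det X P Y Q N \<le> F_maj X P Y Q N"
  unfolding F_det_def F_maj_def
proof (rule cSup_subset_mono)
  show "bdd_above {fidelity Y P'' Q | P''. P'' \<in> dists_on Y \<and>
      (\<exists>P'\<in>dists_on (storage N). majorized X P (storage N) P' \<and> majorized (storage N) P' Y P'')}"
    by (rule bdd_above_fidelity[OF assms(2)])
qed (rule F_det_set_nonempty[OF assms(4,5)] F_det_set_subset[OF assms(1-3)])+

lemma F_det_ge: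
  assumes "finite Y" "f \<in> X \<rightarrow> storage N" "f' \<in> storage N \<rightarrow> Y"
  shows "fidelity Y (map_pmf f' (map_pmf f P)) Q \<le> F_det X P Y Q N"
proof -
  have "bdd_above {fidelity Y (map_pmf f' (map_pmf f P)) Q | f f'.
      f \<in> X \<rightarrow> storage N \<and> f' \<in> storage N \<rightarrow> Y}"
    by (rule bdd_aboveI[of _ 1]) (elim CollectE exE conjE, simp add: fidelity_le_1[OF assms(1)])
  moreover have "fidelity Y (map_pmf f' (map_pmf f P)) Q \<in> {fidelity Y (map_pmf f' (map_pmf f P)) Q | f f'.
      f \<in> X \<rightarrow> storage N \<and> f' \<in> storage N \<rightarrow> Y}"
    using assms(2,3) by (intro CollectI exI[of _ f] exI[of _ f'] conjI refl)
  ultimately show ?thesis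
    unfolding F_det_def by (intro cSup_upper)
qed

lemma F_maj_le:
  assumes "finite X" "finite Y" "P \<in> dists_on X" "Q \<in> dists_on Y" "N \<ge> 0"
    and "\<And>P' P''. P' \<in> dists_on (storage N) \<Longrightarrow> P'' \<in> dists_on Y \<Longrightarrow> majorized X P (storage N) P' \<Longrightarrow>
      majorized (storage N) P' Y P'' \<Longrightarrow> fidelity Y P'' Q \<le> c"
  shows "F_maj X P Y Q N \<le> c"
  unfolding F_maj_def
proof (rule cSup_least)
  have nonempty: "A \<noteq> {} \<Longrightarrow> A \<subseteq> B \<Longrightarrow> B \<noteq> {}" for A B :: "real set"
    by blast
  show "{fidelity Y P'' Q | P''. P'' \<in> dists_on Y \<and>
      (\<exists>P'\<in>dists_on (storage N). majorized X P (storage N) P' \<and> majorized (storage N) P' Y P'')} \<noteq> {}"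
    by (rule nonempty[OF F_det_set_nonempty[OF assms(4,5)] F_det_set_subset[OF assms(1-3)]])
qed (auto intro: assms(6))

lemma majorized_trans:
  "majorized X P Y Q \<Longrightarrow> majorized Y Q Z R \<Longrightarrow> majorized X P Z R"
  by (meson majorized_def order_trans)

text \<open>The storage is forgotten: by transitivity the source is majorized directly by the
  output.\<close>

lemma F_maj_le_source:
  assumes "finite X" "finite Y" "P \<in> dists_on X" "Q \<in> dists_on Y" "N \<ge> 0"
    and "A \<subseteq> X" "1 - \<epsilon> \<le> measure P A" "real (card A) \<le> L"
    and "measure Q {y. q \<le> pmf Q y} \<le> \<delta>" "q \<ge> 0"
  shows "F_maj X P Y Q N \<le> sqrt (\<delta> + L * q) + sqrt \<epsilon>"
proof (rule F_maj_le[OF assms(1-5)])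
  fix P' P'' assume *: "P'' \<in> dists_on Y" "majorized X P (storage N) P'" "majorized (storage N) P' Y P''"
  show "fidelity Y P'' Q \<le> sqrt (\<delta> + L * q) + sqrt \<epsilon>"
    by (rule fidelity_le_of_majorized[OF assms(1,2) *(1) majorized_trans[OF *(2,3)] assms(6-10)])
qed

text \<open>The source is forgotten: \<open>P'\<close> lives entirely on the storage, which
  therefore serves as the concentration set with no lost mass.\<close>

lemma F_maj_le_storage:
  assumes "finite X" "finite Y" "P \<in> dists_on X" "Q \<in> dists_on Y" "N \<ge> 0"
    and "measure Q {y. q \<le> pmf Q y} \<le> \<delta>" "q \<ge> 0"
  shows "F_maj X P Y Q N \<le> sqrt (\<delta> + 2 powr N * q)"
proof (rule F_maj_le[OF assms(1-5)])
  fix P' P'' assume *: "P' \<in> dists_on (storage N)" "P'' \<in> dists_on Y" "majorized (storage N) P' Y P''"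
  have "measure P' (storage N) = 1"
    using *(1) by (simp add: dists_on_def measure_pmf.prob_eq_1 AE_measure_pmf_iff subset_eq)
  then have "1 - 0 \<le> measure P' (storage N)" by simp
  then have "fidelity Y P'' Q \<le> sqrt (\<delta> + 2 powr N * q) + sqrt 0"
    by (rule fidelity_le_of_majorized[OF finite_storage assms(2) *(2,3) subset_refl _
      card_storage_le assms(6,7)])
  then show "fidelity Y P'' Q \<le> sqrt (\<delta> + 2 powr N * q)" by simp
qed

section \<open>Constructing a deterministic conversion\<close>

lemma subset_sum_approx:
  fixes w :: "'a \<Rightarrow> real"
  assumes "finite A" "\<And>x. x \<in> A \<Longrightarrow> 0 \<le> w x \<and> w x \<le> p" "0 \<le> p" "0 \<le> t" "t \<le> sum w A"
  shows "\<exists>C\<subseteq>A. t - p \<le> sum w C \<and> sum w C \<le> t"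
  using assms
proof (induction A)
  case empty
  then show ?case by simp
next
  case (insert x A)
  show ?case
  proof (cases "t \<le> sum w A")
    case True
    then show ?thesis using insert by (metis insertCI subset_insertI2)
  next
    case False
    \<comment> \<open>Without \<open>x\<close> the target is no longer reached, so \<open>A\<close>
      itself is chosen; it falls short by at most the weight of \<open>x\<close>.\<close>
    then have "t - p \<le> sum w A \<and> sum w A \<le> t"
      using insert.prems(4) insert.prems(1)[of x] insert.hyps by simp
    then show ?thesis by blast
  qed
qed

text \<open>The targets are served one after the other; after each of them the remaining weight still
  covers the remaining targets because no target is overfilled.\<close>

lemma greedy_assignment:
  fixes w :: "'a \<Rightarrow> real" and \<tau> :: "'b \<Rightarrow> real"
  assumes "finite B" "finite A" "\<And>x. x \<in> A \<Longrightarrow> 0 \<le> w x \<and> w x \<le> p" "0 \<le> p"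
    and "\<And>y. y \<in> B \<Longrightarrow> 0 \<le> \<tau> y" "sum \<tau> B \<le> sum w A"
  shows "\<exists>g. \<forall>y\<in>B. \<tau> y - p \<le> (\<Sum>x\<in>{x\<in>A. g x = y}. w x)"
  using assms
proof (induction B arbitrary: A)
  case empty
  then show ?case by simp
next
  case (insert y B)
  have \<tau>: "0 \<le> \<tau> y" "0 \<le> sum \<tau> B" using insert.prems(4) by (auto intro: sum_nonneg)
  moreover have total: "\<tau> y + sum \<tau> B \<le> sum w A" using insert by simp
  ultimately obtain C where C: "C \<subseteq> A" "\<tau> y - p \<le> sum w C" "sum w C \<le> \<tau> y"
    using subset_sum_approx[of A w p "\<tau> y"] insert.prems(1-3) by auto
  have "sum w (A - C) = sum w A - sum w C"
    using C(1) insert.prems(1) by (simp add: sum_diff finite_subset)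
  then have "sum \<tau> B \<le> sum w (A - C)" using total C(3) by linarith
  then obtain g where g: "\<And>z. z \<in> B \<Longrightarrow> \<tau> z - p \<le> (\<Sum>x\<in>{x\<in>A - C. g x = z}. w x)"
    using insert.IH[of "A - C"] insert.prems by auto
  \<comment> \<open>On the remaining elements \<open>g\<close> may also take the value
    \<open>y\<close>. Only lower bounds are claimed, so this surplus is harmless.\<close>
  define g' where "g' x = (if x \<in> C then y else g x)" for x
  have "\<tau> z - p \<le> (\<Sum>x\<in>{x\<in>A. g' x = z}. w x)" if z: "z \<in> insert y B" for z
  proof (cases "z = y")
    case True
    have "sum w C \<le> (\<Sum>x\<in>{x\<in>A. g' x = y}. w x)"
      using C(1) insert.prems(1,2) by (intro sum_mono2) (auto simp: g'_def)
    then show ?thesis using C(2) unfolding True by (rule order_trans[rotated])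
  next
    case False
    then have "(\<Sum>x\<in>{x\<in>A - C. g x = z}. w x) \<le> (\<Sum>x\<in>{x\<in>A. g' x = z}. w x)"
      using insert.prems(1,2) by (intro sum_mono2) (auto simp: g'_def)
    then show ?thesis using g[of z] z False by simp
  qed
  then show ?case by blast
qed

lemma fidelity_le_F_det_of_image:
  assumes "finite Y" "g \<in> X \<rightarrow> B" "finite B" "B \<noteq> {}" "B \<subseteq> Y" "real (card B) \<le> 2 powr N"
    and "P \<in> dists_on X"
  shows "fidelity Y (map_pmf g P) Q \<le> F_det X P Y Q N"
proof -
  obtain e where e: "bij_betw e B {0..<card B}"
    using ex_bij_betw_finite_nat[OF assms(3)] by blast
  obtain b where b: "b \<in> B" using assms(4) by blast
  have "card B \<le> nat \<lfloor>2 powr N\<rfloor>"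
    using assms(6) by (simp add: le_nat_iff le_floor_iff)
  then have st: "e x \<in> storage N" if "x \<in> B" for x
    using bij_betwE[OF e] that by (force simp: storage_def)
  \<comment> \<open>Decoding inverts the numbering \<open>e\<close> of \<open>B\<close>; cells
    beyond \<open>card B\<close> get an arbitrary value \<open>b\<close> so that \<open>f'\<close>
    still maps into \<open>Y\<close>.\<close>
  define f' where "f' k = (if k < card B then inv_into B e k else b)" for k
  have inv: "inv_into B e k \<in> B" if "k < card B" for k
    using that e by (metis atLeastLessThan_iff bij_betw_imp_surj_on inv_into_into zero_le)
  have "map_pmf f' (map_pmf (e \<circ> g) P) = map_pmf g P"
    unfolding pmf.map_comp
  proof (rule map_pmf_cong)
    fix x assume "x \<in> set_pmf P"
    then have "g x \<in> B" using assms(2,7) by (auto simp: dists_on_def)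
    then show "(f' \<circ> (e \<circ> g)) x = g x"
      using bij_betwE[OF e] e by (auto simp: f'_def bij_betw_inv_into_left)
  qed simp
  moreover have "fidelity Y (map_pmf f' (map_pmf (e \<circ> g) P)) Q \<le> F_det X P Y Q N"
  proof (rule F_det_ge[OF assms(1)])
    show "e \<circ> g \<in> X \<rightarrow> storage N"
      by (rule Pi_I) (simp add: st funcset_mem[OF assms(2)])
    show "f' \<in> storage N \<rightarrow> Y"
      by (rule Pi_I) (simp add: f'_def subsetD[OF assms(5)] inv b)
  qed
  ultimately show ?thesis by simp
qed

text \<open>The light atoms of \<open>P\<close> are distributed over the heavy atoms of
  \<open>Q\<close>, of which there are at most \<open>1 / q\<close> and hence fit into the storage.
  Targets are scaled by \<open>1 - \<epsilon>\<close> so that the available mass suffices; the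
  rounding error \<open>p\<close> costs at most another \<open>\<epsilon>\<close> fraction of each
  target, and the heavy atoms miss at most \<open>\<epsilon>\<close> of the mass of
  \<open>Q\<close>. This gives the three losses.\<close>

lemma F_det_lower_bound:
  assumes "finite X" "finite Y" "P \<in> dists_on X" "Q \<in> dists_on Y"
    and "measure P {x. p < pmf P x} \<le> \<epsilon>" "measure Q {y. pmf Q y < q} \<le> \<epsilon>"
    and "0 < q" "0 \<le> p" "p \<le> \<epsilon> * q" "1 / q \<le> 2 powr N" "\<epsilon> < 1 / 3"
  shows "1 - 3 * \<epsilon> \<le> F_det X P Y Q N"
proof -
  define A where "A = {x\<in>X. pmf P x \<le> p}"
  define B where "B = {y. q \<le> pmf Q y}"
  have \<epsilon>: "0 \<le> \<epsilon>" using assms(5) measure_nonneg order_trans by blast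
  have finB: "finite B" "real (card B) \<le> 2 powr N"
    using card_pmf_ge[OF assms(7), of Q] assms(10) by (auto simp: B_def)
  have BY: "B \<subseteq> Y"
    using assms(4,7) by (auto simp: B_def dists_on_def set_pmf_eq)
  have finA: "finite A" using assms(1) by (simp add: A_def)
  have "1 = measure P (- {x. p < pmf P x}) + measure P {x. p < pmf P x}"
    using measure_pmf.prob_compl[of "{x. p < pmf P x}" P] by (simp add: Compl_eq_Diff_UNIV)
  also have "measure P (- {x. p < pmf P x}) = measure P A"
    using assms(3) by (intro measure_pmf.finite_measure_eq_AE)
      (auto simp: AE_measure_pmf_iff A_def dists_on_def)
  finally have PA: "1 - \<epsilon> \<le> sum (pmf P) A"
    using assms(5) finA by (simp add: measure_measure_pmf_finite)
  have "1 = measure Q (- {y. pmf Q y < q}) + measure Q {y. pmf Q y < q}"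
    using measure_pmf.prob_compl[of "{y. pmf Q y < q}" Q] by (simp add: Compl_eq_Diff_UNIV)
  also have "- {y. pmf Q y < q} = B" by (auto simp: B_def)
  finally have QB: "1 - \<epsilon> \<le> sum (pmf Q) B"
    using assms(6) finB by (simp add: measure_measure_pmf_finite)
  then have "B \<noteq> {}" using assms(11) by auto
  then obtain b where b: "b \<in> B" by blast
  have "sum (pmf Q) B \<le> 1"
    using finB by (simp flip: measure_measure_pmf_finite)
  then have "(1 - \<epsilon>) * sum (pmf Q) B \<le> 1 - \<epsilon>"
    using assms(11) by (intro mult_left_le) auto
  then have "(\<Sum>y\<in>B. (1 - \<epsilon>) * pmf Q y) \<le> sum (pmf P) A"
    using PA by (simp flip: sum_distrib_left)
  then have "\<exists>g. \<forall>y\<in>B. (1 - \<epsilon>) * pmf Q y - p \<le> (\<Sum>x\<in>{x\<in>A. g x = y}. pmf P x)"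
    using assms(8,11) by (intro greedy_assignment finB finA) (auto simp: A_def)
  then obtain g where g: "\<And>y. y \<in> B \<Longrightarrow> (1 - \<epsilon>) * pmf Q y - p \<le> (\<Sum>x\<in>{x\<in>A. g x = y}. pmf P x)"
    by metis
  \<comment> \<open>The assignment says nothing about values outside \<open>B\<close>. Redirecting
    them to \<open>b\<close> confines the image to \<open>B\<close> and only adds mass
    there.\<close>
  define h where "h x = (if g x \<in> B then g x else b)" for x
  have "(1 - 2 * \<epsilon>) * pmf Q y \<le> pmf (map_pmf h P) y" if y: "y \<in> B" for y
  proof -
    have "\<epsilon> * q \<le> \<epsilon> * pmf Q y" using y \<epsilon> by (intro mult_left_mono) (auto simp: B_def)
    then have "(1 - 2 * \<epsilon>) * pmf Q y \<le> (1 - \<epsilon>) * pmf Q y - p"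
      using assms(9) by (simp add: algebra_simps)
    also have "\<dots> \<le> (\<Sum>x\<in>{x\<in>A. g x = y}. pmf P x)" by (rule g[OF y])
    also have "\<dots> \<le> (\<Sum>x\<in>{x\<in>X. h x = y}. pmf P x)"
      using assms(1) y by (intro sum_mono2) (auto simp: A_def h_def)
    also have "\<dots> = pmf (map_pmf h P) y"
      using pmf_conversion[OF assms(1,3), of h y] by simp
    finally show ?thesis .
  qed
  \<comment> \<open>A nonnegative number below two others is below their geometric mean.\<close>
  then have le: "(1 - 2 * \<epsilon>) * pmf Q y \<le> sqrt (pmf (map_pmf h P) y) * sqrt (pmf Q y)" if "y \<in> B" for y
  proof -
    have "(1 - 2 * \<epsilon>) * pmf Q y \<le> pmf Q y"
      using \<epsilon> by (intro mult_left_le_one_le) (use assms(11) in auto)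
    moreover have "0 \<le> (1 - 2 * \<epsilon>) * pmf Q y" using assms(11) by simp
    ultimately have "((1 - 2 * \<epsilon>) * pmf Q y)\<^sup>2 \<le> pmf (map_pmf h P) y * pmf Q y"
      unfolding power2_eq_square
      using that \<open>\<And>y. y \<in> B \<Longrightarrow> (1 - 2 * \<epsilon>) * pmf Q y \<le> pmf (map_pmf h P) y\<close> by (intro mult_mono) auto
    then show ?thesis by (simp add: real_le_rsqrt flip: real_sqrt_mult)
  qed
  have "1 - 3 * \<epsilon> \<le> (1 - 2 * \<epsilon>) * (1 - \<epsilon>)" using \<epsilon> by (simp add: algebra_simps)
  also have "\<dots> \<le> (1 - 2 * \<epsilon>) * sum (pmf Q) B"
    using QB assms(11) by (intro mult_left_mono) auto
  also have "\<dots> = (\<Sum>y\<in>B. (1 - 2 * \<epsilon>) * pmf Q y)" by (simp add: sum_distrib_left)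
  also have "\<dots> \<le> (\<Sum>y\<in>B. sqrt (pmf (map_pmf h P) y) * sqrt (pmf Q y))"
    using le by (intro sum_mono) auto
  also have "\<dots> \<le> fidelity Y (map_pmf h P) Q"
    unfolding fidelity_def using BY assms(2) by (intro sum_mono2) auto
  also have "\<dots> \<le> F_det X P Y Q N"
    using assms b finB BY \<open>B \<noteq> {}\<close> by (intro fidelity_le_F_det_of_image[of Y h X B]) (auto simp: h_def)
  finally show ?thesis .
qed

section \<open>Asymptotics\<close>

lemma finite_words [simp]: "finite X \<Longrightarrow> finite (words X n)"
  by (simp add: words_def finite_lists_length_eq)

lemma replicate_pmf_dists_on_words: "P \<in> dists_on X \<Longrightarrow> replicate_pmf n P \<in> dists_on (words X n)"
  by (auto simp: dists_on_def words_def set_replicate_pmf)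

lemma tendsto_divide_of_smallo:
  fixes f :: "nat \<Rightarrow> real"
  assumes "(\<lambda>n. f n - c * real n) \<in> o(\<lambda>n. real n)"
  shows "(\<lambda>n. f n / real n) \<longlonglongrightarrow> c"
proof -
  have "(\<lambda>n. (f n - c * real n) / real n + c) \<longlonglongrightarrow> 0 + c"
    by (intro tendsto_add smalloD_tendsto[OF assms] tendsto_const)
  moreover have "eventually (\<lambda>n. (f n - c * real n) / real n + c = f n / real n) sequentially"
    using eventually_gt_at_top[of 0] by eventually_elim (simp add: field_simps)
  ultimately show ?thesis
    by (simp add: filterlim_cong)
qed

text \<open>The exponent \<open>2/3\<close> exceeds \<open>1/2\<close>, so the squared deviation
  outgrows a variance linear in \<open>n\<close>; being below 1, it stays negligible on the
  exponential scale.\<close>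

lemma chebyshev_bound_tendsto_0:
  assumes "(\<lambda>n. T n / real n) \<longlonglongrightarrow> t"
  shows "(\<lambda>n. T n * V / (real n powr (2/3))\<^sup>2) \<longlonglongrightarrow> 0"
proof -
  have "(\<lambda>n. T n / real n * (V * (real n / (real n powr (2/3))\<^sup>2))) \<longlonglongrightarrow> t * (V * 0)"
    by (intro tendsto_mult assms tendsto_const) real_asymp
  moreover have "eventually (\<lambda>n. T n / real n * (V * (real n / (real n powr (2/3))\<^sup>2)) =
      T n * V / (real n powr (2/3))\<^sup>2) sequentially"
    using eventually_gt_at_top[of 0] by eventually_elim (simp add: field_simps)
  ultimately have "(\<lambda>n. T n * V / (real n powr (2/3))\<^sup>2) \<longlonglongrightarrow> t * (V * 0)"
    by (rule Lim_transform_eventually)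
  then show ?thesis by simp
qed

text \<open>Bounds the mass that a set of size \<open>2 powr r n\<close> can collect from words less
  likely than the threshold. The total exponent divided by \<open>n\<close> has a negative limit, so
  the exponent itself tends to minus infinity.\<close>

lemma powr_exponent_gap_tendsto_0:
  fixes r T :: "nat \<Rightarrow> real"
  assumes "(\<lambda>n. r n / real n) \<longlonglongrightarrow> \<rho>" "(\<lambda>n. T n / real n) \<longlonglongrightarrow> t" "\<rho> < t * H"
  shows "(\<lambda>n. 2 powr r n * 2 powr - (T n * H - real n powr (2/3))) \<longlonglongrightarrow> 0"
proof -
  have "(\<lambda>n. real n powr (2/3) / real n) \<longlonglongrightarrow> 0"
    by real_asymp
  then have "(\<lambda>n. (r n / real n - T n / real n * H + real n powr (2/3) / real n) * ln 2)
      \<longlonglongrightarrow> (\<rho> - t * H + 0) * ln 2"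
    by (intro tendsto_intros assms)
  moreover have "(\<rho> - t * H + 0) * ln 2 < 0"
    using assms(3) by (simp add: mult_neg_pos)
  ultimately have "filterlim (\<lambda>n. (r n / real n - T n / real n * H + real n powr (2/3) / real n) * ln 2
      * real n) at_bot sequentially"
    by (intro filterlim_tendsto_neg_mult_at_bot[OF _ _ filterlim_real_sequentially])
  then have "(\<lambda>n. exp ((r n / real n - T n / real n * H + real n powr (2/3) / real n) * ln 2
      * real n)) \<longlonglongrightarrow> 0"
    by (rule filterlim_compose[OF exp_at_bot])
  moreover have "eventually (\<lambda>n. exp ((r n / real n - T n / real n * H + real n powr (2/3) / real n)
      * ln 2 * real n) = 2 powr r n * 2 powr - (T n * H - real n powr (2/3))) sequentially"
    using eventually_gt_at_top[of 0]
    by eventually_elim (simp add: powr_def field_simps flip: exp_add)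
  ultimately show ?thesis
    by (simp add: filterlim_cong)
qed

section \<open>Converse: the rate bounds\<close>

lemma liminf_less_of_le_tendsto_0:
  fixes f b :: "nat \<Rightarrow> real"
  assumes "eventually (\<lambda>n. f n \<le> b n) sequentially" "b \<longlonglongrightarrow> 0" "\<nu> > 0"
  shows "\<not> ereal \<nu> \<le> liminf (\<lambda>n. ereal (f n))"
proof -
  have "liminf (\<lambda>n. ereal (f n)) \<le> liminf (\<lambda>n. ereal (b n))"
    using assms(1) by (intro Liminf_mono) simp
  also have "\<dots> = ereal 0"
    using assms(2) by (intro lim_imp_Liminf) auto
  finally show ?thesis
    using assms(3) by (auto dest: order_trans)
qed

text \<open>A strong converse: beyond either bound the fidelity tends to 0, so any positive
  \<open>\<nu>\<close> is excluded.\<close>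

lemma liminf_F_maj_imp_rate_bounds:
  assumes "finite X" "finite Y" "P \<in> dists_on X" "Q \<in> dists_on Y" "\<nu> > 0"
    and S0: "\<And>n. 0 \<le> S n"
    and S: "(\<lambda>n. S n - s * real n) \<in> o(\<lambda>n. real n)"
    and T: "(\<lambda>n. real (T n) - t * real n) \<in> o(\<lambda>n. real n)"
    and liminf: "ereal \<nu> \<le> liminf (\<lambda>n. ereal
      (F_maj (words X n) (replicate_pmf n P) (words Y (T n)) (replicate_pmf (T n) Q) (S n)))"
  shows "t * shannon_entropy Y Q \<le> s" and "t * shannon_entropy Y Q \<le> shannon_entropy X P"
proof -
  define a where "a n = real n powr (2/3)" for n
  \<comment> \<open>The typical probability under the target, raised by the fluctuation: words at
    least this likely have mass at most \<open>\<delta> n\<close>.\<close>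
  define q where "q n = 2 powr - (real (T n) * shannon_entropy Y Q - a n)" for n
  define \<delta> where "\<delta> n = real (T n) * info_variance Q / (a n)\<^sup>2" for n
  have fin: "finite (set_pmf P)" "finite (set_pmf Q)"
    using assms(1-4) by (auto simp: dists_on_def intro: finite_subset)
  have T': "(\<lambda>n. real (T n) / real n) \<longlonglongrightarrow> t" and S': "(\<lambda>n. S n / real n) \<longlonglongrightarrow> s"
    using T S by (auto intro: tendsto_divide_of_smallo)
  have a: "a n > 0" if "n > 0" for n using that by (simp add: a_def)
  have \<delta>: "measure (replicate_pmf (T n) Q) {ys. q n \<le> pmf (replicate_pmf (T n) Q) ys} \<le> \<delta> n"
    if "n > 0" for n
    using measure_large_pmf[OF fin(2) a[OF that], of "T n"]
    by (simp add: q_def \<delta>_def shannon_entropy_set_pmf[OF assms(2,4)])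
  have \<delta>0: "\<delta> \<longlonglongrightarrow> 0"
    unfolding \<delta>_def a_def by (rule chebyshev_bound_tendsto_0[OF T'])
  show "t * shannon_entropy Y Q \<le> s"
  proof (rule ccontr)
    assume "\<not> t * shannon_entropy Y Q \<le> s"
    then have "(\<lambda>n. 2 powr S n * q n) \<longlonglongrightarrow> 0"
      unfolding q_def a_def by (intro powr_exponent_gap_tendsto_0[OF S' T']) simp
    then have "(\<lambda>n. sqrt (\<delta> n + 2 powr S n * q n)) \<longlonglongrightarrow> sqrt (0 + 0)"
      by (intro tendsto_intros \<delta>0)
    moreover have "eventually (\<lambda>n. F_maj (words X n) (replicate_pmf n P) (words Y (T n))
        (replicate_pmf (T n) Q) (S n) \<le> sqrt (\<delta> n + 2 powr S n * q n)) sequentially"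
      using eventually_gt_at_top[of 0]
      by eventually_elim (intro F_maj_le_storage finite_words replicate_pmf_dists_on_words
        assms(1-4) S0 \<delta>, auto simp: q_def)
    ultimately show False
      using liminf_less_of_le_tendsto_0[OF _ _ \<open>\<nu> > 0\<close>] liminf by simp
  qed
  show "t * shannon_entropy Y Q \<le> shannon_entropy X P"
  proof (rule ccontr)
    assume less: "\<not> t * shannon_entropy Y Q \<le> shannon_entropy X P"
    define r where "r n = real n * shannon_entropy X P + a n" for n
    define \<epsilon> where "\<epsilon> n = real n * info_variance P / (a n)\<^sup>2" for n
    \<comment> \<open>Cutting off only the unlikely words suffices: the lower bound on the
      probability already limits the size to \<open>2 powr r n\<close>, and the discarded mass
      vanishes.\<close>
    define A where "A n = {xs. 2 powr - r n \<le> pmf (replicate_pmf n P) xs}" for n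
    have "(\<lambda>n. shannon_entropy X P + a n / real n) \<longlonglongrightarrow> shannon_entropy X P + 0"
      unfolding a_def by (intro tendsto_add tendsto_const) real_asymp
    moreover have "eventually (\<lambda>n. shannon_entropy X P + a n / real n = r n / real n) sequentially"
      using eventually_gt_at_top[of 0] by eventually_elim (simp add: r_def field_simps)
    ultimately have r: "(\<lambda>n. r n / real n) \<longlonglongrightarrow> shannon_entropy X P"
      by (simp add: filterlim_cong)
    have AX: "A n \<subseteq> words X n" for n
    proof
      fix xs assume "xs \<in> A n"
      then have "0 < pmf (replicate_pmf n P) xs"
        using less_le_trans[of 0 "2 powr - r n"] by (simp add: A_def)
      then show "xs \<in> words X n"
        using replicate_pmf_dists_on_words[OF assms(3), of n]
        by (auto simp: dists_on_def pmf_positive_iff)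
    qed
    have A1: "real (card (A n)) \<le> 2 powr r n" for n
      using card_pmf_ge(2)[of "2 powr - r n" "replicate_pmf n P"] by (simp add: A_def powr_minus_divide)
    have A2: "1 - \<epsilon> n \<le> measure (replicate_pmf n P) (A n)" if "n > 0" for n
    proof -
      have "1 - measure (replicate_pmf n P) (A n) = measure (replicate_pmf n P) (- A n)"
        using measure_pmf.prob_compl[of "A n" "replicate_pmf n P"] by (simp add: Compl_eq_Diff_UNIV)
      also have "\<dots> \<le> measure (replicate_pmf n P) {xs. pmf (replicate_pmf n P) xs \<le> 2 powr - r n}"
        by (intro measure_pmf.finite_measure_mono) (auto simp: A_def)
      also have "\<dots> \<le> \<epsilon> n"
        using measure_small_pmf[OF fin(1) a[OF that], of n]
        by (simp add: r_def \<epsilon>_def shannon_entropy_set_pmf[OF assms(1,3)])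
      finally show ?thesis by simp
    qed
    have "(\<lambda>n. real n / real n) \<longlonglongrightarrow> 1" by real_asymp
    then have "\<epsilon> \<longlonglongrightarrow> 0"
      unfolding \<epsilon>_def a_def by (rule chebyshev_bound_tendsto_0)
    moreover have "(\<lambda>n. 2 powr r n * q n) \<longlonglongrightarrow> 0"
      unfolding q_def a_def using less by (intro powr_exponent_gap_tendsto_0[OF r T']) simp
    ultimately have "(\<lambda>n. sqrt (\<delta> n + 2 powr r n * q n) + sqrt (\<epsilon> n)) \<longlonglongrightarrow> sqrt (0 + 0) + sqrt 0"
      by (intro tendsto_intros \<delta>0)
    moreover have "eventually (\<lambda>n. F_maj (words X n) (replicate_pmf n P) (words Y (T n))
        (replicate_pmf (T n) Q) (S n) \<le> sqrt (\<delta> n + 2 powr r n * q n) + sqrt (\<epsilon> n)) sequentially"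
      using eventually_gt_at_top[of 0]
      by eventually_elim (intro F_maj_le_source[OF _ _ _ _ _ AX A2 A1] finite_words
        replicate_pmf_dists_on_words assms(1-4) S0 \<delta>, auto simp: q_def)
    ultimately show False
      using liminf_less_of_le_tendsto_0[OF _ _ \<open>\<nu> > 0\<close>] liminf by simp
  qed
qed

section \<open>Achievability, including the boundary of the region\<close>

text \<open>On the boundary there is no linear slack, so the room for the fluctuations must come
  from a sublinear reduction of \<open>T\<close>. The exponent \<open>3/4\<close> lies between the
  \<open>2/3\<close> of the fluctuations and the 1 allowed by the rate.\<close>

lemma F_det_eventually_ge:
  assumes "finite X" "finite Y" "P \<in> dists_on X" "Q \<in> dists_on Y"
    and H: "shannon_entropy Y Q > 0" and "t > 0"
    and t: "t * shannon_entropy Y Q \<le> s" "t * shannon_entropy Y Q \<le> shannon_entropy X P"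
    and T: "T = (\<lambda>n. nat \<lfloor>t * real n - real n powr (3/4)\<rfloor>)"
    and "\<nu> < 1"
  shows "eventually (\<lambda>n. \<nu> \<le> F_det (words X n) (replicate_pmf n P) (words Y (T n))
    (replicate_pmf (T n) Q) (s * real n)) sequentially"
    and "(\<lambda>n. real (T n) - t * real n) \<in> o(\<lambda>n. real n)"
proof -
  define HP HQ where "HP = shannon_entropy X P" and "HQ = shannon_entropy Y Q"
  \<comment> \<open>Once the argument is nonnegative, \<open>nat\<close> does not truncate, and the
    floor bounds \<open>T n\<close> from both sides.\<close>
  have "eventually (\<lambda>n. 0 \<le> t * real n - real n powr (3/4)) sequentially"
    using \<open>t > 0\<close> by real_asymp
  then have T_bounds: "eventually (\<lambda>n. real (T n) \<le> t * real n - real n powr (3/4) \<and>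
      t * real n - real n powr (3/4) - 1 \<le> real (T n)) sequentially"
    by eventually_elim (simp add: T; linarith)
  then have "eventually (\<lambda>n. norm (real (T n) - t * real n) \<le> norm (real n powr (3/4) + 1)) sequentially"
  proof eventually_elim
    case (elim n)
    have "real n powr (3/4) \<ge> 0" by simp
    then show ?case
      using conjunct1[OF elim] conjunct2[OF elim] unfolding real_norm_def by linarith
  qed
  then have "(\<lambda>n. real (T n) - t * real n) \<in> O(\<lambda>n. real n powr (3/4) + 1)"
    by (rule landau_o.big_mono)
  also have "(\<lambda>n. real n powr (3/4) + 1) \<in> o(\<lambda>n. real n)"
    by real_asymp
  finally show Tn: "(\<lambda>n. real (T n) - t * real n) \<in> o(\<lambda>n. real n)" .
  \<comment> \<open>Chosen so that \<open>1 - 3 * \<epsilon>\<close> equals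
    \<open>max \<nu> (1/2)\<close>; the maximum keeps \<open>\<epsilon>\<close> below
    \<open>1/3\<close> even for small \<open>\<nu>\<close>.\<close>
  define \<epsilon> where "\<epsilon> = (1 - max \<nu> (1/2)) / 3"
  have \<epsilon>: "\<epsilon> > 0" "\<epsilon> < 1 / 3" "\<nu> \<le> 1 - 3 * \<epsilon>"
    using \<open>\<nu> < 1\<close> by (auto simp: \<epsilon>_def max_def field_simps)
  define a where "a n = real n powr (2/3)" for n
  define p where "p n = 2 powr - (real n * HP - a n)" for n
  define q where "q n = 2 powr - (real (T n) * HQ + a n)" for n
  have fin: "finite (set_pmf P)" "finite (set_pmf Q)"
    using assms(1-4) by (auto simp: dists_on_def intro: finite_subset)
  have HQ0: "HQ > 0" using H by (simp add: HQ_def)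
  have "(\<lambda>n. real n / real n) \<longlonglongrightarrow> 1" by real_asymp
  then have "(\<lambda>n. real n * info_variance P / (a n)\<^sup>2) \<longlonglongrightarrow> 0"
    unfolding a_def by (rule chebyshev_bound_tendsto_0)
  then have "eventually (\<lambda>n. real n * info_variance P / (a n)\<^sup>2 < \<epsilon>) sequentially"
    using \<epsilon>(1) by (rule order_tendstoD)
  moreover have "(\<lambda>n. real (T n) * info_variance Q / (a n)\<^sup>2) \<longlonglongrightarrow> 0"
    unfolding a_def by (rule chebyshev_bound_tendsto_0[OF tendsto_divide_of_smallo[OF Tn]])
  then have "eventually (\<lambda>n. real (T n) * info_variance Q / (a n)\<^sup>2 < \<epsilon>) sequentially"
    using \<epsilon>(1) by (rule order_tendstoD)
  \<comment> \<open>One \<open>a n\<close> for the fluctuation of the source, one for that of the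
    target, and \<open>log 2 \<epsilon>\<close> for the required ratio of \<open>p n\<close> to
    \<open>q n\<close>.\<close>
  moreover have "eventually (\<lambda>n. 2 * a n - HQ * real n powr (3/4) \<le> log 2 \<epsilon>) sequentially"
    unfolding a_def using HQ0 by real_asymp
  ultimately show "eventually (\<lambda>n. \<nu> \<le> F_det (words X n) (replicate_pmf n P) (words Y (T n))
    (replicate_pmf (T n) Q) (s * real n)) sequentially"
    using T_bounds eventually_gt_at_top[of 0]
  proof eventually_elim
    case (elim n)
    have a: "a n > 0" using elim(5) by (simp add: a_def)
    have "real (T n) * HQ \<le> (t * real n - real n powr (3/4)) * HQ"
      using elim(4) HQ0 by (intro mult_right_mono) auto
    moreover have "t * HQ * real n \<le> s * real n" "t * HQ * real n \<le> HP * real n"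
      using t by (auto simp: HQ_def HP_def intro!: mult_right_mono)
    ultimately have TH: "real (T n) * HQ \<le> s * real n - HQ * real n powr (3/4)"
      "real (T n) * HQ \<le> HP * real n - HQ * real n powr (3/4)"
      by (auto simp: algebra_simps)
    have "log 2 \<epsilon> \<le> 0" using \<epsilon> by simp
    have "measure (replicate_pmf n P) {xs. p n < pmf (replicate_pmf n P) xs}
        \<le> measure (replicate_pmf n P) {xs. p n \<le> pmf (replicate_pmf n P) xs}"
      by (intro measure_pmf.finite_measure_mono) auto
    also have "\<dots> \<le> \<epsilon>"
      using measure_large_pmf[OF fin(1) a, of n] elim(1)
      by (simp add: p_def HP_def shannon_entropy_set_pmf[OF assms(1,3)])
    finally have mP: "measure (replicate_pmf n P) {xs. p n < pmf (replicate_pmf n P) xs} \<le> \<epsilon>" .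
    have "measure (replicate_pmf (T n) Q) {ys. pmf (replicate_pmf (T n) Q) ys < q n}
        \<le> measure (replicate_pmf (T n) Q) {ys. pmf (replicate_pmf (T n) Q) ys \<le> q n}"
      by (intro measure_pmf.finite_measure_mono) auto
    also have "\<dots> \<le> \<epsilon>"
      using measure_small_pmf[OF fin(2) a, of "T n"] elim(2)
      by (simp add: q_def HQ_def shannon_entropy_set_pmf[OF assms(2,4)])
    finally have mQ: "measure (replicate_pmf (T n) Q) {ys. pmf (replicate_pmf (T n) Q) ys < q n} \<le> \<epsilon>" .
    have "p n \<le> 2 powr (log 2 \<epsilon> - (real (T n) * HQ + a n))"
      unfolding p_def using TH(2) elim(3) by (intro powr_mono) (auto simp: mult.commute)
    also have "\<dots> = \<epsilon> * q n"
      using \<epsilon>(1) by (simp add: q_def powr_diff powr_minus_divide powr_add)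
    finally have pq: "p n \<le> \<epsilon> * q n" .
    have "1 / q n = 2 powr (real (T n) * HQ + a n)"
      unfolding q_def powr_minus divide_inverse by simp
    \<comment> \<open>The slack reserved for comparing \<open>p n\<close> with \<open>q n\<close>
      also covers the storage, because \<open>log 2 \<epsilon>\<close> is nonpositive and only one
      \<open>a n\<close> has to be absorbed.\<close>
    also have "\<dots> \<le> 2 powr (s * real n)"
      using TH(1) elim(3) a \<open>log 2 \<epsilon> \<le> 0\<close> by (intro powr_mono) auto
    finally have "1 - 3 * \<epsilon> \<le> F_det (words X n) (replicate_pmf n P) (words Y (T n))
        (replicate_pmf (T n) Q) (s * real n)"
      using assms(1-4) mP mQ pq \<epsilon>(2)
      by (intro F_det_lower_bound[where p = "p n" and q = "q n"])
         (auto simp: p_def q_def intro: replicate_pmf_dists_on_words)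
    then show ?case using \<epsilon>(3) by linarith
  qed
qed

theorem theorem16:
  fixes X :: "'a set" and Y :: "'b set"
    and P :: "'a pmf" and Q :: "'b pmf"
    and \<nu> :: real
  assumes "finite X" and "finite Y"
    and "P \<in> dists_on X" and "Q \<in> dists_on Y"
    and "shannon_entropy Y Q > 0"
    and "0 < \<nu>" and "\<nu> < 1"
  shows "rate_region F_det X P Y Q \<nu> = rate_region F_maj X P Y Q \<nu> \<and>
         rate_region F_maj X P Y Q \<nu> =
           {(s\<^sub>1, t\<^sub>1). 0 < s\<^sub>1 \<and> 0 < t\<^sub>1 \<and>
              t\<^sub>1 \<le> min (shannon_entropy X P) s\<^sub>1 / shannon_entropy Y Q}"
proof -
  let ?R = "{(s\<^sub>1, t\<^sub>1). 0 < s\<^sub>1 \<and> 0 < t\<^sub>1 \<and>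
    t\<^sub>1 \<le> min (shannon_entropy X P) s\<^sub>1 / shannon_entropy Y Q}"
  have bound_iff: "t \<le> min (shannon_entropy X P) s / shannon_entropy Y Q \<longleftrightarrow>
      t * shannon_entropy Y Q \<le> shannon_entropy X P \<and> t * shannon_entropy Y Q \<le> s" for s t
    using assms(5) by (simp add: pos_le_divide_eq)
  have det_maj: "rate_region F_det X P Y Q \<nu> \<subseteq> rate_region F_maj X P Y Q \<nu>"
  proof -
    have "ereal \<nu> \<le> liminf (\<lambda>n. ereal
        (F_maj (words X n) (replicate_pmf n P) (words Y (T n)) (replicate_pmf (T n) Q) (S n)))"
      if S: "\<forall>n. 0 \<le> S n" and "ereal \<nu> \<le> liminf (\<lambda>n. ereal
        (F_det (words X n) (replicate_pmf n P) (words Y (T n)) (replicate_pmf (T n) Q) (S n)))" for S T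
    proof -
      have "F_det (words X n) (replicate_pmf n P) (words Y (T n)) (replicate_pmf (T n) Q) (S n)
          \<le> F_maj (words X n) (replicate_pmf n P) (words Y (T n)) (replicate_pmf (T n) Q) (S n)" for n
        using S by (intro F_det_le_F_maj finite_words replicate_pmf_dists_on_words assms(1-4)) simp
      then show ?thesis
        by (intro order_trans[OF that(2)] Liminf_mono always_eventually) simp
    qed
    then show ?thesis
      unfolding rate_region_def by (clarsimp, blast)
  qed
  have maj_R: "rate_region F_maj X P Y Q \<nu> \<subseteq> ?R"
  proof (clarsimp simp: rate_region_def bound_iff)
    fix s t :: real and S :: "nat \<Rightarrow> real" and T :: "nat \<Rightarrow> nat"
    assume *: "\<forall>n. 0 \<le> S n" "(\<lambda>n. S n - s * real n) \<in> o(real)" "(\<lambda>n. real (T n) - t * real n) \<in> o(real)"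
      "ereal \<nu> \<le> liminf (\<lambda>n. ereal
        (F_maj (words X n) (replicate_pmf n P) (words Y (T n)) (replicate_pmf (T n) Q) (S n)))"
    show "t * shannon_entropy Y Q \<le> shannon_entropy X P \<and> t * shannon_entropy Y Q \<le> s"
      using liminf_F_maj_imp_rate_bounds[OF assms(1-4,6) spec[OF *(1)] *(2-4)] by blast
  qed
  have R_det: "?R \<subseteq> rate_region F_det X P Y Q \<nu>"
  proof safe
    fix s t :: real
    assume "0 < s" "0 < t" "t \<le> min (shannon_entropy X P) s / shannon_entropy Y Q"
    then have t: "t * shannon_entropy Y Q \<le> s" "t * shannon_entropy Y Q \<le> shannon_entropy X P"
      by (auto simp: bound_iff)
    define T where "T = (\<lambda>n. nat \<lfloor>t * real n - real n powr (3/4)\<rfloor>)"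
    note ach = F_det_eventually_ge[OF assms(1-5) \<open>0 < t\<close> t T_def assms(7)]
    have "ereal \<nu> \<le> liminf (\<lambda>n. ereal
        (F_det (words X n) (replicate_pmf n P) (words Y (T n)) (replicate_pmf (T n) Q) (s * real n)))"
      using ach(1) by (intro Liminf_bounded) simp
    moreover have "(\<lambda>n. s * real n - s * real n) \<in> o(\<lambda>n. real n)" "\<forall>n. 0 \<le> s * real n"
      using \<open>0 < s\<close> by simp_all
    ultimately show "(s, t) \<in> rate_region F_det X P Y Q \<nu>"
      unfolding rate_region_def using ach(2) \<open>0 < s\<close> \<open>0 < t\<close>
      by (intro CollectI case_prodI conjI exI[of _ "\<lambda>n. s * real n"] exI[of _ T])
  qed
  \<comment> \<open>The three inclusions form a cycle through both regions and \<open>?R\<close>, so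
    all of them are equalities.\<close>
  show ?thesis
    by (intro conjI subset_antisym[OF det_maj subset_trans[OF maj_R R_det]]
      subset_antisym[OF maj_R subset_trans[OF R_det det_maj]])
qed

end
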